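(* Let $K$ be a nonempty compact subset of $X$ and let $F:X\to 2^Y$ be a set-valued mapping. Assume that $F$ is $-C$-lower semicontinuous and strictly $p$-$C$-convexlike on $K$ with nonempty, $-C$-convex and $-C$-compact values. Then the weak $p$-minimal solution set $W_p(F,K)$ and the $p$-minimal solution set $E_p(F,K)$ are both contractible.
   Context: $X$ is a (real) normed vector space, $Y$ is a (real) Banach space, and $C\subseteq Y$ is a convex, closed, pointed cone with nonempty interior $\operatorname{int}C$. For nonempty $A,B\subseteq Y$: $A\le^p B$ means that either $A=B$ or $\left(\bigcap_{a\in A}(a+C)\right)\cap B\neq\emptyset$; $A\ll^p B$ means $\left(\bigcap_{a\in A}(a+C)+\operatorname{int}C\right)\cap B\neq\emptyset$. $E_p(F,K)$ is the set of $x_0\in K$ such that for every $x\in K$, $F(x)\le^p F(x_0)$ implies $F(x_0)\le^p F(x)$. $W_p(F,K)$ is the set of $x_0\in K$ such that for every $x\in K$, $F(x)\ll^p F(x_0)$ implies $F(x_0)\ll^p F(x)$. $F$ is strictly $p$-$C$-convexlike on $K$ if for any $x_1,x_2\in K$ with $x_1\neq x_2$ and any $t\in(0,1)$ there exists $x_3\in K$ such that $F(x_3)\ll^p tF(x_1)+(1-t)F(x_2)$. A set $A\subseteq Y$ is $-C$-convex if $A-C$ is convex, and $-C$-compact if any cover of $A$ of the form $\{U_\alpha-C: U_\alpha \text{ open}\}$ admits a finite subcover. "With ... values" means that $F(x)$ has the stated properties for $x\in K$. $F$ is $-C$-lower semicontinuous at $u_0$ if for any $x\in F(u_0)$ and any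 neighborhood $V$ of $x$ there is a neighborhood $U(u_0)$ of $u_0$ such that $F(u)\cap(V+C)\neq\emptyset$ for every $u\in U(u_0)$; it is so on $K$ if it is so at each point of $K$. A nonempty set $A$ in a topological space is contractible if there exist $x_0\in A$ and a continuous mapping $H:A\times[0,1]\to A$ such that $H(x,1)=x$ and $H(x,0)=x_0$ for any $x\in A$. *)

theory Defs
  imports "HOL-Analysis.Analysis"
begin

text \<open>Minkowski sums are written with the operations \<open>+\<close> and \<open>+o\<close> of
  \<open>HOL-Library.Set_Algebras\<close>. As \<open>-\<close> on sets is set difference, the algebraic
  difference of \<open>A\<close> and \<open>C\<close> is written \<open>A + uminus ` C\<close>.\<close>

definition pointed_cone :: "'b::real_vector set \<Rightarrow> bool" where
  "pointed_cone C \<longleftrightarrow> cone C \<and> C \<inter> uminus ` C = {0}"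

text \<open>The two relations are intended for nonempty sets only: an intersection over the
  empty set would be \<open>UNIV\<close>.\<close>

definition le_p :: "'b::real_normed_vector set \<Rightarrow> 'b set \<Rightarrow> 'b set \<Rightarrow> bool" where
  "le_p C A B \<longleftrightarrow> A = B \<or> (\<Inter>a\<in>A. a +o C) \<inter> B \<noteq> {}"

definition ll_p :: "'b::real_normed_vector set \<Rightarrow> 'b set \<Rightarrow> 'b set \<Rightarrow> bool" where
  "ll_p C A B \<longleftrightarrow> ((\<Inter>a\<in>A. a +o C) + interior C) \<inter> B \<noteq> {}"

definition E_p :: "'b::real_normed_vector set \<Rightarrow> ('a \<Rightarrow> 'b set) \<Rightarrow> 'a set \<Rightarrow> 'a set" where
  "E_p C F K = {x0 \<in> K. \<forall>x\<in>K. le_p C (F x) (F x0) \<longrightarrow> le_p C (F x0) (F x)}"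

definition W_p :: "'b::real_normed_vector set \<Rightarrow> ('a \<Rightarrow> 'b set) \<Rightarrow> 'a set \<Rightarrow> 'a set" where
  "W_p C F K = {x0 \<in> K. \<forall>x\<in>K. ll_p C (F x) (F x0) \<longrightarrow> ll_p C (F x0) (F x)}"

definition strictly_p_convexlike_on ::
    "'b::real_normed_vector set \<Rightarrow> ('a \<Rightarrow> 'b set) \<Rightarrow> 'a set \<Rightarrow> bool" where
  "strictly_p_convexlike_on C F K \<longleftrightarrow>
     (\<forall>x1\<in>K. \<forall>x2\<in>K. \<forall>t\<in>{0<..<1::real}. x1 \<noteq> x2 \<longrightarrow>
        (\<exists>x3\<in>K. ll_p C (F x3) ((*\<^sub>R) t ` F x1 + (*\<^sub>R) (1 - t) ` F x2)))"

definition neg_cone_convex :: "'b::real_normed_vector set \<Rightarrow> 'b set \<Rightarrow> bool" where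
  "neg_cone_convex C A \<longleftrightarrow> convex (A + uminus ` C)"

definition neg_cone_compact :: "'b::real_normed_vector set \<Rightarrow> 'b set \<Rightarrow> bool" where
  "neg_cone_compact C A \<longleftrightarrow>
     (\<forall>\<U>. (\<forall>U\<in>\<U>. open U) \<and> A \<subseteq> (\<Union>U\<in>\<U>. U + uminus ` C) \<longrightarrow>
        (\<exists>\<V>\<subseteq>\<U>. finite \<V> \<and> A \<subseteq> (\<Union>U\<in>\<V>. U + uminus ` C)))"

text \<open>The neighbourhoods of \<open>u0\<close> are taken in the whole space on which \<open>F\<close> is defined,
  also when \<open>u0\<close> is restricted to a subset \<open>K\<close>.\<close>

definition neg_cone_lsc_at ::
    "'b::real_normed_vector set \<Rightarrow> ('a::real_normed_vector \<Rightarrow> 'b set) \<Rightarrow> 'a \<Rightarrow> bool" where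
  "neg_cone_lsc_at C F u0 \<longleftrightarrow>
     (\<forall>x\<in>F u0. \<forall>V. open V \<and> x \<in> V \<longrightarrow>
        (\<exists>U. open U \<and> u0 \<in> U \<and> (\<forall>u\<in>U. F u \<inter> (V + C) \<noteq> {})))"

definition neg_cone_lsc_on ::
    "'b::real_normed_vector set \<Rightarrow> ('a::real_normed_vector \<Rightarrow> 'b set) \<Rightarrow> 'a set \<Rightarrow> bool" where
  "neg_cone_lsc_on C F K \<longleftrightarrow> (\<forall>u0\<in>K. neg_cone_lsc_at C F u0)"

end

theory Submission
  imports Defs
begin

text \<open>
  Fix \<open>e\<close> in the interior of \<open>C\<close>, and for a convex lower set \<open>T\<close> of the target space look for
  \<open>u \<in> K\<close> minimising the least \<open>s\<close> such that \<open>F u\<close> lies below a point of \<open>T + s e\<close>. Strict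
  convexlikeness makes all approximate minimisers cluster at a single point, and this point is
  weakly minimal.

  As \<open>F\<close> need not be upper semicontinuous on the solution set, \<open>T = F x - C\<close> would in general not
  give a point depending continuously on \<open>x\<close>. It is therefore regularised by the set-valued
  inf-convolution \<open>T\<^sub>k(x) = (\<Inter>u\<in>K. F u - C + k \<parallel>x - u\<parallel> e)\<close>, which is convex and Lipschitz in \<open>x\<close>,
  independent of \<open>x\<close> for \<open>k = 0\<close>, contained in \<open>F x - C\<close>, and which exhausts \<open>F x - C\<close>, up to
  \<open>\<delta> e\<close>, as \<open>k \<rightarrow> \<infinity>\<close>. Running \<open>k = 1/t - 1\<close> from \<open>\<infinity>\<close> to \<open>0\<close>, the corresponding minimisers
  contract \<open>W_p\<close> to a point. Finally \<open>E_p = W_p\<close>, again by strict convexlikeness.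
\<close>

text \<open>Hides the convergent subsequence: the arguments below ask for a single late index whose
  term is close to \<open>l\<close>.\<close>

lemma compact_cluster_point:
  fixes u :: "nat \<Rightarrow> 'a::metric_space"
  assumes "compact K" "\<And>n. u n \<in> K"
  obtains l where "l \<in> K" "\<And>r m. r > 0 \<Longrightarrow> \<exists>n\<ge>m. dist (u n) l < r"
proof -
  obtain l f where l: "l \<in> K" "strict_mono f" "(u \<circ> f) \<longlonglongrightarrow> l"
    using assms unfolding compact_def by meson
  have "\<exists>n\<ge>m. dist (u n) l < r" if r: "r > 0" for r m
  proof -
    obtain N where N: "\<And>n. n \<ge> N \<Longrightarrow> dist ((u \<circ> f) n) l < r"
      using tendstoD[OF l(3) r] unfolding eventually_sequentially by blast
    have "f (max N m) \<ge> m" using seq_suble[OF l(2), of "max N m"] by simp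
    moreover have "dist (u (f (max N m))) l < r" using N[of "max N m"] by simp
    ultimately show ?thesis by blast
  qed
  with l(1) show thesis by (rule that)
qed

section \<open>The setting, with \<open>e\<close> as an order unit\<close>

text \<open>Pointedness enters through \<open>minus_e\<close>: it makes \<open>r *\<^sub>R e\<close>
  lie in \<open>C\<close> exactly when \<open>r \<ge> 0\<close>, so multiples of \<open>e\<close>
  form a faithful scale for comparing sets.\<close>

locale strict_cone_problem =
  fixes C :: "'b::real_normed_vector set" and e :: 'b
    and F :: "'a::real_normed_vector \<Rightarrow> 'b set" and K :: "'a set"
  assumes cone_add: "\<And>x y. x \<in> C \<Longrightarrow> y \<in> C \<Longrightarrow> x + y \<in> C"
    and cone_scale: "\<And>x r. x \<in> C \<Longrightarrow> 0 \<le> r \<Longrightarrow> r *\<^sub>R x \<in> C"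
    and e_interior: "e \<in> interior C"
    and minus_e: "- e \<notin> C"
    and K_compact: "compact K" and K_nonempty: "K \<noteq> {}"
    and lsc: "neg_cone_lsc_on C F K"
    and strict: "strictly_p_convexlike_on C F K"
    and values_nonempty: "\<And>x. x \<in> K \<Longrightarrow> F x \<noteq> {}"
    and values_convex: "\<And>x. x \<in> K \<Longrightarrow> neg_cone_convex C (F x)"
    and values_compact: "\<And>x. x \<in> K \<Longrightarrow> neg_cone_compact C (F x)"
begin

lemma e_in: "e \<in> C"
  using e_interior interior_subset by blast

lemma scale_e: "0 \<le> r \<Longrightarrow> r *\<^sub>R e \<in> C"
  using cone_scale e_in by blast

lemma zero_in: "0 \<in> C"
  using scale_e[of 0] by simp

lemma cone_add_eq: "\<lbrakk>x \<in> C; y \<in> C; z = x + y\<rbrakk> \<Longrightarrow> z \<in> C"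
  using cone_add by simp

lemma scale_e_nonneg: "r *\<^sub>R e \<in> C \<Longrightarrow> 0 \<le> r"
  using cone_scale[of "r *\<^sub>R e" "inverse (- r)"] minus_e
  by (cases "r < 0") (auto simp: divide_simps)

text \<open>\<open>C\<close> contains a ball of radius \<open>d\<close> around \<open>e\<close>;
  being a cone, it also contains this ball scaled by \<open>M / d\<close>. Thus \<open>e\<close> is
  an order unit, uniformly on bounded sets.\<close>

lemma absorb_ball: "\<exists>r\<ge>0. \<forall>y\<in>ball 0 N. r *\<^sub>R e + y \<in> C"
proof -
  obtain d where d: "d > 0" "ball e d \<subseteq> C"
    using e_interior mem_interior by blast
  \<comment> \<open>\<open>M\<close> stays positive even for \<open>N \<le> 0\<close>, where the
    ball is empty.\<close>
  define M where "M = \<bar>N\<bar> + 1"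
  have "(M / d) *\<^sub>R e + y \<in> C" if "y \<in> ball 0 N" for y
  proof -
    have "norm y < M" using that by (auto simp: M_def)
    then have "e + (d / M) *\<^sub>R y \<in> ball e d"
      using d by (simp add: dist_norm M_def pos_divide_less_eq)
    then have "(M / d) *\<^sub>R (e + (d / M) *\<^sub>R y) \<in> C"
      using d by (intro cone_scale) (auto simp: M_def)
    moreover have "(M / d) * (d / M) = 1" using d by (simp add: M_def)
    ultimately show ?thesis
      by (simp add: scaleR_add_right)
  qed
  then show ?thesis
    using d by (intro exI[of _ "M / d"]) (auto simp: M_def)
qed

lemma absorb: "\<exists>r\<ge>0. r *\<^sub>R e + y \<in> C"
  using absorb_ball[of "norm y + 1"] by auto

lemma scale_e_interior: "r > 0 \<Longrightarrow> r *\<^sub>R e \<in> interior C"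
proof -
  assume r: "r > 0"
  obtain d where d: "d > 0" "ball e d \<subseteq> C"
    using e_interior mem_interior by blast
  have "ball (r *\<^sub>R e) (r * d) \<subseteq> C"
  proof
    fix y assume "y \<in> ball (r *\<^sub>R e) (r * d)"
    then have "norm (r *\<^sub>R (e - inverse r *\<^sub>R y)) < r * d"
      using r by (simp add: dist_norm algebra_simps)
    then have "inverse r *\<^sub>R y \<in> ball e d"
      using r by (simp add: dist_norm)
    then have "r *\<^sub>R (inverse r *\<^sub>R y) \<in> C"
      using d r by (intro cone_scale[of "inverse r *\<^sub>R y"]) auto
    then show "y \<in> C" using r by simp
  qed
  then show ?thesis
    using r d mem_interior by (metis mult_pos_pos)
qed

text \<open>A short step along \<open>- e\<close> stays in a ball around \<open>c\<close> inside
  \<open>C\<close>. The summand 1 in \<open>N\<close> makes it positive without an appeal to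
  \<open>e \<noteq> 0\<close>.\<close>

lemma interior_minus_e:
  assumes "c \<in> interior C"
  obtains d where "d > 0" "c - d *\<^sub>R e \<in> C"
proof -
  obtain r where r: "r > 0" "ball c r \<subseteq> C"
    using assms mem_interior by blast
  define N where "N = norm e + 1"
  have N: "N > 0" by (simp add: N_def add_nonneg_pos)
  define d where "d = r / (2 * N)"
  have "d > 0" using r N by (simp add: d_def)
  moreover have "norm (d *\<^sub>R e) < r"
  proof -
    have "d * norm e \<le> d * N" using \<open>d > 0\<close> by (simp add: N_def)
    also have "\<dots> = r / 2" using N by (simp add: d_def)
    finally show ?thesis using r \<open>d > 0\<close> by simp
  qed
  then have "c - d *\<^sub>R e \<in> ball c r"
    by (simp add: dist_norm)
  ultimately show thesis using r that by blast
qed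

section \<open>The set relations as pointwise inequalities\<close>

text \<open>Trades the interior for a scalar margin \<open>d\<close>: interior points stay in
  \<open>C\<close> after a small step along \<open>- e\<close>, and positive multiples of
  \<open>e\<close> are interior. Later proofs add such inequalities and balance their
  margins.\<close>

lemma ll_p_iff: "ll_p C A B \<longleftrightarrow> (\<exists>b\<in>B. \<exists>d>0. \<forall>a\<in>A. b - d *\<^sub>R e - a \<in> C)"
proof
  assume "ll_p C A B"
  then obtain q c where q: "\<And>a. a \<in> A \<Longrightarrow> q \<in> a +o C" and c: "c \<in> interior C"
    and b: "q + c \<in> B"
    unfolding ll_p_def by (auto simp: set_plus_def)
  obtain d where d: "d > 0" "c - d *\<^sub>R e \<in> C"
    using interior_minus_e[OF c] .
  have "q + c - d *\<^sub>R e - a \<in> C" if "a \<in> A" for a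
  proof -
    have "q - a \<in> C" using q[OF that] by (auto simp: elt_set_plus_def)
    from cone_add[OF this d(2)] show ?thesis by (simp add: algebra_simps)
  qed
  with b d show "\<exists>b\<in>B. \<exists>d>0. \<forall>a\<in>A. b - d *\<^sub>R e - a \<in> C" by blast
next
  assume "\<exists>b\<in>B. \<exists>d>0. \<forall>a\<in>A. b - d *\<^sub>R e - a \<in> C"
  then obtain b d where bd: "b \<in> B" "d > 0" "\<And>a. a \<in> A \<Longrightarrow> b - d *\<^sub>R e - a \<in> C" by blast
  have "b - d *\<^sub>R e \<in> (\<Inter>a\<in>A. a +o C)"
    using bd(3) by (auto simp: elt_set_plus_def intro!: bexI[of _ "b - d *\<^sub>R e - _"])
  then have "(b - d *\<^sub>R e) + d *\<^sub>R e \<in> (\<Inter>a\<in>A. a +o C) + interior C"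
    using scale_e_interior[OF bd(2)] by (rule set_plus_intro)
  with bd(1) show "ll_p C A B" unfolding ll_p_def by auto
qed

lemma le_p_iff: "le_p C A B \<longleftrightarrow> A = B \<or> (\<exists>b\<in>B. \<forall>a\<in>A. b - a \<in> C)"
proof -
  have "b \<in> a +o C \<longleftrightarrow> b - a \<in> C" for a b
    by (auto simp: elt_set_plus_def intro!: bexI[of _ "b - a"])
  then show ?thesis unfolding le_p_def by blast
qed

section \<open>Lower sets of the values and uniform bounds\<close>

text \<open>This is \<open>A - C\<close>, phrased so that membership hands over a dominating point
  of \<open>A\<close>.\<close>

definition down :: "'b set \<Rightarrow> 'b set" where
  "down A = {y. \<exists>a\<in>A. a - y \<in> C}"

lemma downI: "a \<in> A \<Longrightarrow> a - y \<in> C \<Longrightarrow> y \<in> down A"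
  by (auto simp: down_def)

lemma subset_down: "A \<subseteq> down A"
  using zero_in by (auto intro: downI)

lemma down_closed:
  assumes "y \<in> down A" "y - y' \<in> C" shows "y' \<in> down A"
proof -
  obtain a where "a \<in> A" "a - y \<in> C" using assms(1) by (auto simp: down_def)
  with cone_add[OF this(2) assms(2)] show ?thesis by (auto intro: downI)
qed

lemma down_values_convex: "x \<in> K \<Longrightarrow> convex (down (F x))"
proof -
  assume "x \<in> K"
  have "down (F x) = F x + uminus ` C"
    by (auto simp: down_def set_plus_def algebra_simps intro: bexI[of _ "_ - _"])
      (metis add_diff_cancel_left' diff_add_cancel minus_diff_eq)
  then show ?thesis using values_convex[OF \<open>x \<in> K\<close>] by (simp add: neg_cone_convex_def)
qed

text \<open>Apply semicontinuity to the set \<open>V\<close> of points exceeding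
  \<open>y - d *\<^sub>R e\<close> by an interior element of \<open>C\<close>. Every point of
  \<open>V + C\<close> still lies above \<open>y - d *\<^sub>R e\<close>, so a value meeting it has
  this point in its lower set.\<close>

lemma lsc_near:
  assumes "x \<in> K" "y \<in> F x" "d > 0"
  obtains r where "r > 0" "\<And>u. dist u x < r \<Longrightarrow> y - d *\<^sub>R e \<in> down (F u)"
proof -
  define V where "V = (\<lambda>v. v - (y - d *\<^sub>R e)) -` interior C"
  have "open V" unfolding V_def by (intro open_vimage continuous_intros) auto
  moreover have "y \<in> V" using scale_e_interior[OF assms(3)] by (simp add: V_def)
  moreover have "neg_cone_lsc_at C F x" using lsc assms(1) by (simp add: neg_cone_lsc_on_def)
  ultimately obtain U where U: "open U" "x \<in> U" "\<forall>u\<in>U. F u \<inter> (V + C) \<noteq> {}"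
    unfolding neg_cone_lsc_at_def using assms(2) by meson
  obtain r where r: "r > 0" "ball x r \<subseteq> U" using U(1,2) openE by metis
  have "y - d *\<^sub>R e \<in> down (F u)" if "dist u x < r" for u
  proof -
    have "u \<in> U" using r that by (auto simp: dist_commute)
    then obtain p where "p \<in> F u" "p \<in> V + C" using U(3) by blast
    then obtain v c where vc: "v \<in> V" "c \<in> C" "v + c \<in> F u"
      by (auto simp: set_plus_def)
    have "v - (y - d *\<^sub>R e) \<in> C"
      using vc(1) interior_subset[of C] by (auto simp: V_def)
    from cone_add[OF this vc(2)] show ?thesis
      using vc by (intro downI[of "v + c"]) (auto simp: algebra_simps)
  qed
  with r(1) that show thesis by blast
qed

text \<open>If no \<open>R\<close> worked, points violating larger and larger bounds would cluster
  at some \<open>l\<close> in \<open>K\<close>; near \<open>l\<close>, semicontinuity supplies one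
  fixed point below all values.\<close>

lemma lower_bound:
  obtains R where "R \<ge> 0" "\<And>u. u \<in> K \<Longrightarrow> - (R *\<^sub>R e) \<in> down (F u)"
proof (rule ccontr)
  assume "\<not> thesis"
  then have "\<forall>n::nat. \<exists>u\<in>K. - (real n *\<^sub>R e) \<notin> down (F u)"
    using that of_nat_0_le_iff by blast
  then obtain u where u: "\<And>n. u n \<in> K" "\<And>n::nat. - (real n *\<^sub>R e) \<notin> down (F (u n))"
    by metis
  obtain l where l: "l \<in> K" "\<And>r m. r > 0 \<Longrightarrow> \<exists>n\<ge>m. dist (u n) l < r"
    using compact_cluster_point[of K u] K_compact u(1) by blast
  obtain y where y: "y \<in> F l" using values_nonempty[OF l(1)] by blast
  obtain r where r: "r > 0" "\<And>u. dist u l < r \<Longrightarrow> y - 1 *\<^sub>R e \<in> down (F u)"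
    using lsc_near[OF l(1) y, of 1] by auto
  obtain q where q: "q \<ge> 0" "q *\<^sub>R e + y \<in> C" using absorb by blast
  \<comment> \<open>The extra unit pays for the loss \<open>1 *\<^sub>R e\<close> from
    semicontinuity.\<close>
  obtain m :: nat where m: "real m \<ge> q + 1" using real_arch_simple by blast
  obtain n where n: "n \<ge> m" "dist (u n) l < r" using l(2)[OF r(1)] by blast
  have "real n \<ge> q + 1" using m n(1) by linarith
  then have "(real n - 1 - q) *\<^sub>R e \<in> C" by (intro scale_e) simp
  from cone_add[OF this q(2)]
  have "y - 1 *\<^sub>R e - (- (real n *\<^sub>R e)) \<in> C" by (simp add: algebra_simps)
  with r(2)[OF n(2)] have "- (real n *\<^sub>R e) \<in> down (F (u n))" by (rule down_closed)
  with u(2) show False by blast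
qed

text \<open>Cover \<open>F x\<close> by the sets \<open>U - C\<close> with \<open>U\<close> a ball
  of integer radius. A finite subcover puts \<open>F x\<close> below a bounded set, which a multiple
  of \<open>e\<close> dominates.\<close>

lemma upper_bound:
  assumes "x \<in> K" obtains R where "R \<ge> 0" "\<And>a. a \<in> F x \<Longrightarrow> R *\<^sub>R e - a \<in> C"
proof -
  define \<U> where "\<U> = range (\<lambda>n::nat. ball (0::'b) (real n))"
  have "F x \<subseteq> (\<Union>U\<in>\<U>. U + uminus ` C)"
  proof
    fix a assume "a \<in> F x"
    obtain n where "norm a < real n" using reals_Archimedean2 by blast
    then have "a + - 0 \<in> ball 0 (real n) + uminus ` C"
      using zero_in by (intro set_plus_intro) auto
    then show "a \<in> (\<Union>U\<in>\<U>. U + uminus ` C)" by (auto simp: \<U>_def)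
  qed
  then obtain \<V> where V: "\<V> \<subseteq> \<U>" "finite \<V>" "F x \<subseteq> (\<Union>U\<in>\<V>. U + uminus ` C)"
    using values_compact[OF assms] unfolding neg_cone_compact_def \<U>_def
    by (metis (no_types, lifting) imageE open_ball)
  have "bounded (\<Union>\<V>)" using V(1,2) by (auto simp: \<U>_def)
  then obtain N where N: "\<And>v. v \<in> \<Union>\<V> \<Longrightarrow> norm v < N" using bounded_pos_less by metis
  obtain r where r: "r \<ge> 0" "\<And>y. y \<in> ball 0 N \<Longrightarrow> r *\<^sub>R e + y \<in> C" using absorb_ball by blast
  have "r *\<^sub>R e - a \<in> C" if a: "a \<in> F x" for a
  proof -
    obtain U where U: "U \<in> \<V>" "a \<in> U + uminus ` C" using subsetD[OF V(3) a] by blast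
    from U(2) obtain v c where vc: "v \<in> U" "c \<in> C" "a = v + - c"
      by (elim set_plus_elim imageE) auto
    have "r *\<^sub>R e + (- v) \<in> C" using N vc(1) U(1) by (intro r(2)) auto
    from cone_add[OF this vc(2)] show ?thesis by (simp add: vc(3) algebra_simps)
  qed
  with r(1) that show thesis by blast
qed

section \<open>Weak minimality and equality of the two solution sets\<close>

text \<open>Adding the two inequalities cancels \<open>a\<close> and \<open>b\<close> and would put
  a negative multiple of \<open>e\<close> into \<open>C\<close>.\<close>

lemma ll_p_not_reverse: "\<lbrakk>ll_p C A B; \<exists>a\<in>A. \<forall>b\<in>B. a - b \<in> C\<rbrakk> \<Longrightarrow> False"
proof -
  assume "ll_p C A B" "\<exists>a\<in>A. \<forall>b\<in>B. a - b \<in> C"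
  then obtain a b d where "b - d *\<^sub>R e - a \<in> C" "a - b \<in> C" "d > 0"
    unfolding ll_p_iff by metis
  from cone_add[OF this(1,2)] have "(- d) *\<^sub>R e \<in> C" by simp
  from scale_e_nonneg[OF this] \<open>d > 0\<close> show False by simp
qed

lemma ll_p_irrefl: "\<not> ll_p C A A"
proof
  assume "ll_p C A A"
  then obtain b d where "b - d *\<^sub>R e - b \<in> C" "d > 0"
    unfolding ll_p_iff by metis
  then show False using scale_e_nonneg[of "- d"] by simp
qed

lemma ll_p_weaken: "ll_p C A B \<Longrightarrow> \<exists>b\<in>B. \<forall>a\<in>A. b - a \<in> C"
proof -
  assume "ll_p C A B"
  then obtain b d where bd: "b \<in> B" "d > 0" "\<And>a. a \<in> A \<Longrightarrow> b - d *\<^sub>R e - a \<in> C"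
    unfolding ll_p_iff by metis
  have "b - a \<in> C" if "a \<in> A" for a
    using cone_add[OF bd(3)[OF that] scale_e[of d]] bd(2) by simp
  with bd show ?thesis by blast
qed

text \<open>Strict domination is asymmetric, so the implication defining \<open>W_p\<close> can hold
  only vacuously.\<close>

lemma W_p_iff: "x \<in> W_p C F K \<longleftrightarrow> x \<in> K \<and> (\<forall>u\<in>K. \<not> ll_p C (F u) (F x))"
  unfolding W_p_def using ll_p_weaken ll_p_not_reverse by blast

text \<open>Strict convexlikeness at \<open>t = 1/2\<close>. The margin \<open>d\<close> is the gain
  behind all uniqueness and stability arguments below.\<close>

lemma strict_midpoint:
  assumes "u \<in> K" "w \<in> K" "u \<noteq> w"
  obtains v y z d where "v \<in> K" "y \<in> F u" "z \<in> F w" "d > 0"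
    "\<And>a. a \<in> F v \<Longrightarrow> (1/2) *\<^sub>R (y + z) - d *\<^sub>R e - a \<in> C"
proof -
  have "(1/2::real) \<in> {0<..<1}" by simp
  then obtain v where v: "v \<in> K" "ll_p C (F v) ((*\<^sub>R) (1/2) ` F u + (*\<^sub>R) (1 - 1/2) ` F w)"
    using strict assms unfolding strictly_p_convexlike_on_def by meson
  then obtain b d where b: "b \<in> (*\<^sub>R) (1/2) ` F u + (*\<^sub>R) (1 - 1/2) ` F w"
    and d: "d > 0" "\<And>a. a \<in> F v \<Longrightarrow> b - d *\<^sub>R e - a \<in> C"
    unfolding ll_p_iff by blast
  from b obtain y z where yz: "y \<in> F u" "z \<in> F w" "b = (1/2) *\<^sub>R (y + z)"
    by (auto simp: set_plus_def scaleR_add_right)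
  show thesis using that[OF v(1) yz(1,2) d(1)] d(2) yz(3) by blast
qed

lemma half_convex: "\<lbrakk>convex A; a \<in> A; b \<in> A\<rbrakk> \<Longrightarrow> (1/2) *\<^sub>R (a + b) \<in> A"
  for A :: "'b set"
  using convexD[of A a b "1/2" "1/2"] by (simp add: scaleR_add_right)

lemma ll_p_downI:
  assumes "b \<in> down B" "d > 0" "\<And>a. a \<in> A \<Longrightarrow> b - d *\<^sub>R e - a \<in> C"
  shows "ll_p C A B"
proof -
  obtain b' where b': "b' \<in> B" "b' - b \<in> C" using assms(1) by (auto simp: down_def)
  have "b' - d *\<^sub>R e - a \<in> C" if "a \<in> A" for a
    using b'(2) assms(3)[OF that] by (rule cone_add_eq) simp
  with b' assms(2) show ?thesis unfolding ll_p_iff by blast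
qed

text \<open>Otherwise the midpoint of a point of \<open>F u\<close> and one of \<open>F x\<close>
  lies in the convex set \<open>down (F x)\<close>, and strict convexlikeness yields a value
  strictly below it, against weak minimality of \<open>x\<close>.\<close>

lemma W_p_minimal_unique:
  assumes x: "x \<in> W_p C F K" and u: "u \<in> K" and le: "F u \<subseteq> down (F x)"
  shows "u = x"
proof (rule ccontr)
  assume "u \<noteq> x"
  moreover have "x \<in> K" using x by (simp add: W_p_iff)
  ultimately obtain v y z d where v: "v \<in> K" "y \<in> F u" "z \<in> F x" "d > 0"
    "\<And>a. a \<in> F v \<Longrightarrow> (1/2) *\<^sub>R (y + z) - d *\<^sub>R e - a \<in> C"
    using strict_midpoint[OF u] by metis
  have "(1/2) *\<^sub>R (y + z) \<in> down (F x)"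
    using v(2,3) le subset_down \<open>x \<in> K\<close> by (intro half_convex down_values_convex) auto
  then have "ll_p C (F v) (F x)" using v(4,5) by (rule ll_p_downI)
  with x v(1) show False by (simp add: W_p_iff)
qed

text \<open>A strict dominator of a point of \<open>E_p\<close> would have to be dominated back,
  which asymmetry excludes. Conversely, anything below a weakly minimal \<open>x\<close> is
  \<open>x\<close> itself by \<open>W_p_minimal_unique\<close>.\<close>

lemma E_p_eq_W_p: "E_p C F K = W_p C F K"
proof (intro equalityI subsetI)
  fix x assume x: "x \<in> E_p C F K"
  have "\<not> ll_p C (F u) (F x)" if u: "u \<in> K" for u
  proof
    assume ll: "ll_p C (F u) (F x)"
    then have "le_p C (F x) (F u)"
      using x u ll_p_weaken unfolding E_p_def le_p_iff by blast
    with ll ll_p_irrefl ll_p_not_reverse show False unfolding le_p_iff by metis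
  qed
  with x show "x \<in> W_p C F K" by (simp add: W_p_iff E_p_def)
next
  fix x assume x: "x \<in> W_p C F K"
  have "u = x" if "u \<in> K" "le_p C (F u) (F x)" for u
    using x that(1)
  proof (rule W_p_minimal_unique)
    show "F u \<subseteq> down (F x)"
      using that(2) subset_down unfolding le_p_iff by (auto intro: downI)
  qed
  then show "x \<in> E_p C F K"
    using x unfolding E_p_def by (auto simp: W_p_iff)
qed

section \<open>Scalarised minimisation relative to a convex lower set\<close>

text \<open>A nonlinear scalarisation along \<open>e\<close>: \<open>s\<close> is a distance by
  which \<open>F u\<close> can be pushed down to lie below a single point of
  \<open>T\<close>.\<close>

definition feasible :: "'b set \<Rightarrow> real \<Rightarrow> 'a \<Rightarrow> bool" where
  "feasible T s u \<longleftrightarrow> (\<exists>b\<in>T. \<forall>a\<in>F u. b + s *\<^sub>R e - a \<in> C)"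

definition target_value :: "'b set \<Rightarrow> real" where
  "target_value T = Inf {s. \<exists>u\<in>K. feasible T s u}"

text \<open>The last clause keeps the infimum \<open>target_value T\<close> from being taken over a set that is
  unbounded below.\<close>

definition admissible :: "'b set \<Rightarrow> bool" where
  "admissible T \<longleftrightarrow> convex T \<and> (\<forall>y\<in>T. \<forall>y'. y - y' \<in> C \<longrightarrow> y' \<in> T) \<and> T \<noteq> {} \<and>
     (\<forall>s. \<forall>u\<in>K. feasible T s u \<longrightarrow> 0 \<le> s)"

text \<open>The infimum \<open>target_value T\<close> need not be attained, hence the limit points of approximate
  minimisers.\<close>

definition approx_minimizer :: "'b set \<Rightarrow> 'a \<Rightarrow> bool" where
  "approx_minimizer T u \<longleftrightarrow> u \<in> K \<and> (\<forall>d>0. \<exists>u'\<in>K. dist u' u < d \<and> feasible T (target_value T + d) u')"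

lemma admissible_lower: "\<lbrakk>admissible T; y \<in> T; y - y' \<in> C\<rbrakk> \<Longrightarrow> y' \<in> T"
  unfolding admissible_def by blast

lemma feasible_mono: "\<lbrakk>feasible T s u; s \<le> s'\<rbrakk> \<Longrightarrow> feasible T s' u"
  unfolding feasible_def
proof (elim bexE, intro bexI ballI)
  fix b a assume "s \<le> s'" "\<forall>a\<in>F u. b + s *\<^sub>R e - a \<in> C" "a \<in> F u"
  then show "b + s' *\<^sub>R e - a \<in> C"
    using cone_add[of "b + s *\<^sub>R e - a" "(s' - s) *\<^sub>R e"] scale_e[of "s' - s"]
    by (simp add: algebra_simps)
qed

lemma feasible_exists:
  assumes "admissible T" shows "\<exists>s. \<exists>u\<in>K. feasible T s u"
proof -
  obtain u where u: "u \<in> K" using K_nonempty by blast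
  obtain b where b: "b \<in> T" using assms by (auto simp: admissible_def)
  obtain R where R: "\<And>a. a \<in> F u \<Longrightarrow> R *\<^sub>R e - a \<in> C" using upper_bound[OF u] by blast
  obtain r where r: "r *\<^sub>R e + b \<in> C" using absorb by blast
  have "b + (R + r) *\<^sub>R e - a \<in> C" if "a \<in> F u" for a
    by (rule cone_add_eq[OF r R[OF that]]) (simp add: algebra_simps)
  then have "feasible T (R + r) u" using b unfolding feasible_def by blast
  with u show ?thesis by blast
qed

lemma target_value_le: "\<lbrakk>admissible T; u \<in> K; feasible T s u\<rbrakk> \<Longrightarrow> target_value T \<le> s"
  unfolding target_value_def by (rule cInf_lower) (auto simp: admissible_def intro!: bdd_belowI)

lemma target_value_nonneg: "admissible T \<Longrightarrow> 0 \<le> target_value T"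
  unfolding target_value_def using feasible_exists by (intro cInf_greatest) (auto simp: admissible_def)

lemma target_value_approx:
  assumes "admissible T" "d > 0" shows "\<exists>u\<in>K. feasible T (target_value T + d) u"
proof -
  have "\<exists>s\<in>{s. \<exists>u\<in>K. feasible T s u}. s < target_value T + d"
    unfolding target_value_def using assms feasible_exists
    by (intro cInf_lessD) (auto simp: admissible_def)
  then obtain s u where "u \<in> K" "feasible T s u" "s < target_value T + d" by blast
  then show ?thesis using feasible_mono[of T s u "target_value T + d"] by auto
qed

text \<open>Near-minimisers with errors \<open>1 / Suc n\<close> cluster in the compact set
  \<open>K\<close>; a late index makes both the error and the distance to the cluster point
  small.\<close>

lemma approx_minimizer_exists:
  assumes "admissible T" shows "\<exists>u. approx_minimizer T u"
proof -
  have "\<forall>n::nat. \<exists>u\<in>K. feasible T (target_value T + 1 / Suc n) u"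
    using target_value_approx[OF assms] by simp
  then obtain u where u: "\<And>n. u n \<in> K" "\<And>n::nat. feasible T (target_value T + 1 / Suc n) (u n)"
    by metis
  obtain l where l: "l \<in> K" "\<And>r m. r > 0 \<Longrightarrow> \<exists>n\<ge>m. dist (u n) l < r"
    using compact_cluster_point[of K u] K_compact u(1) by blast
  have "\<exists>u'\<in>K. dist u' l < d \<and> feasible T (target_value T + d) u'" if d: "d > 0" for d
  proof -
    obtain m where m: "1 / Suc m < d" using d nat_approx_posE by blast
    obtain n where n: "n \<ge> m" "dist (u n) l < d" using l(2)[OF d] by blast
    have "1 / Suc n \<le> 1 / Suc m" using n(1) by (intro divide_left_mono) auto
    with m have "feasible T (target_value T + d) (u n)" by (intro feasible_mono[OF u(2)]) simp
    with n u(1) show ?thesis by blast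
  qed
  with l(1) show ?thesis unfolding approx_minimizer_def by blast
qed

text \<open>Averages a point of \<open>T\<close> above \<open>F u'\<close> with the given point of
  \<open>T\<close> built from \<open>z\<close>, and gains from strictness. Since \<open>v\<close>
  and \<open>d\<close> are fixed before \<open>T\<close> and \<open>u'\<close>, the gain is uniform
  over all targets, which later gives stability when the target varies.\<close>

lemma feasible_improve_target:
  assumes "u \<in> K" "w \<in> K" "u \<noteq> w"
  obtains v z d where "v \<in> K" "z \<in> F w" "d > 0"
    "\<And>u' T s s'. \<lbrakk>dist u' u < d; admissible T; feasible T s u'; z - (d + s') *\<^sub>R e \<in> T\<rbrakk>
       \<Longrightarrow> feasible T ((s + s') / 2 - d) v"
proof -
  obtain v y z d where v: "v \<in> K" "y \<in> F u" "z \<in> F w" "d > 0"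
    "\<And>a. a \<in> F v \<Longrightarrow> (1/2) *\<^sub>R (y + z) - d *\<^sub>R e - a \<in> C"
    using strict_midpoint[OF assms] by metis
  obtain r where r: "r > 0" "\<And>u'. dist u' u < r \<Longrightarrow> y - (d/4) *\<^sub>R e \<in> down (F u')"
    using lsc_near[OF assms(1) v(2), of "d/4"] v(4) by auto
  \<comment> \<open>The margin \<open>d\<close> must cover \<open>d/8\<close> (half the
    semicontinuity loss), \<open>q/2\<close> (half the shift of \<open>z\<close>) and the claimed
    gain \<open>q\<close>; with \<open>q \<le> d/4\<close> these sum to at most
    \<open>d/2\<close>.\<close>
  define q where "q = min r (d/4)"
  have q: "q > 0" "q \<le> r" "q \<le> d/4" using r v by (auto simp: q_def)
  show thesis
  proof (rule that[OF v(1,3) q(1)])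
    fix u' T s s'
    assume u': "dist u' u < q" and T: "admissible T" and f: "feasible T s u'"
      and z: "z - (q + s') *\<^sub>R e \<in> T"
    obtain b where b: "b \<in> T" "\<And>a. a \<in> F u' \<Longrightarrow> b + s *\<^sub>R e - a \<in> C"
      using f unfolding feasible_def by blast
    obtain a' where a': "a' \<in> F u'" "a' - (y - (d/4) *\<^sub>R e) \<in> C"
      using r(2)[of u'] u' q by (auto simp: down_def)
    define b' where "b' = (1/2) *\<^sub>R (b + (z - (q + s') *\<^sub>R e))"
    have "b' \<in> T" unfolding b'_def using T b z by (intro half_convex) (auto simp: admissible_def)
    moreover have "b' + ((s + s') / 2 - q) *\<^sub>R e - a \<in> C" if "a \<in> F v" for a
    proof -
      have 1: "(b + s *\<^sub>R e - a') + (a' - (y - (d/4) *\<^sub>R e)) \<in> C"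
        using b(2)[OF a'(1)] a'(2) by (rule cone_add)
      have 2: "(1/2) *\<^sub>R ((b + s *\<^sub>R e - a') + (a' - (y - (d/4) *\<^sub>R e))) \<in> C"
        using 1 by (rule cone_scale) simp
      have 3: "(d - d/8 - q - q/2) *\<^sub>R e \<in> C" using q v(4) by (intro scale_e) linarith
      have split: "b' + ((s + s') / 2 - q) *\<^sub>R e - a
        = ((1/2) *\<^sub>R (y + z) - d *\<^sub>R e - a)
          + (1/2) *\<^sub>R ((b + s *\<^sub>R e - a') + (a' - (y - (d/4) *\<^sub>R e)))
          + (d - d/8 - q - q/2) *\<^sub>R e"
        by (simp add: b'_def algebra_simps add_divide_distrib) (simp flip: scaleR_add_left)
      show ?thesis unfolding split by (intro cone_add v(5) that 2 3)
    qed
    ultimately show "feasible T ((s + s') / 2 - q) v" unfolding feasible_def by blast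
  qed
qed

text \<open>Reduces to the previous lemma: semicontinuity puts \<open>z - d *\<^sub>R e\<close>
  below a point of \<open>F w'\<close>, which feasibility pushes below \<open>T\<close> after a
  shift by \<open>s'\<close>.\<close>

lemma feasible_improve:
  assumes "u \<in> K" "w \<in> K" "u \<noteq> w"
  obtains v d where "v \<in> K" "d > 0"
    "\<And>u' w' T s s'. \<lbrakk>dist u' u < d; dist w' w < d; admissible T; feasible T s u'; feasible T s' w'\<rbrakk>
       \<Longrightarrow> feasible T ((s + s') / 2 - d) v"
proof -
  obtain v z d where v: "v \<in> K" "z \<in> F w" "d > 0" and imp:
    "\<And>u' T s s'. \<lbrakk>dist u' u < d; admissible T; feasible T s u'; z - (d + s') *\<^sub>R e \<in> T\<rbrakk>
       \<Longrightarrow> feasible T ((s + s') / 2 - d) v"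
    using feasible_improve_target[OF assms] by metis
  obtain r where r: "r > 0" "\<And>w'. dist w' w < r \<Longrightarrow> z - d *\<^sub>R e \<in> down (F w')"
    using lsc_near[OF assms(2) v(2,3)] by auto
  show thesis
  proof (rule that[of v "min d r"])
    fix u' w' T s s'
    assume u': "dist u' u < min d r" "dist w' w < min d r" and T: "admissible T"
      and f: "feasible T s u'" "feasible T s' w'"
    obtain a where a: "a \<in> F w'" "a - (z - d *\<^sub>R e) \<in> C"
      using r(2)[of w'] u' by (auto simp: down_def)
    obtain b where b: "b \<in> T" "b + s' *\<^sub>R e - a \<in> C" using f(2) a(1) unfolding feasible_def by blast
    have "b - (z - (d + s') *\<^sub>R e) \<in> C"
      by (rule cone_add_eq[OF b(2) a(2)]) (simp add: algebra_simps)
    with T b(1) have "z - (d + s') *\<^sub>R e \<in> T" by (rule admissible_lower)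
    then have "feasible T ((s + s') / 2 - d) v" using u' T f by (intro imp) auto
    then show "feasible T ((s + s') / 2 - min d r) v" by (rule feasible_mono) simp
  qed (use v r in auto)
qed

text \<open>Near two distinct approximate minimisers there are points feasible at
  \<open>target_value T + d/2\<close>; the improvement by \<open>d\<close> then undercuts the
  infimum.\<close>

lemma approx_minimizer_unique:
  assumes T: "admissible T" and u: "approx_minimizer T u" and w: "approx_minimizer T w"
  shows "u = w"
proof (rule ccontr)
  assume "u \<noteq> w"
  then obtain v d where v: "v \<in> K" "d > 0" and imp:
    "\<And>u' w' T s s'. \<lbrakk>dist u' u < d; dist w' w < d; admissible T; feasible T s u'; feasible T s' w'\<rbrakk>
       \<Longrightarrow> feasible T ((s + s') / 2 - d) v"
    using feasible_improve[of u w] u w unfolding approx_minimizer_def by metis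
  obtain u' where u': "dist u' u < d/2" "feasible T (target_value T + d/2) u'"
    using u v(2) unfolding approx_minimizer_def by (meson half_gt_zero)
  obtain w' where w': "dist w' w < d/2" "feasible T (target_value T + d/2) w'"
    using w v(2) unfolding approx_minimizer_def by (meson half_gt_zero)
  have "feasible T ((target_value T + d/2 + (target_value T + d/2)) / 2 - d) v"
    using u'(1) w'(1) v(2) by (intro imp[OF _ _ T u'(2) w'(2)]) auto
  from target_value_le[OF T v(1) this] v(2) show False by (simp add: field_simps)
qed

text \<open>Meaningful for admissible \<open>T\<close>, where existence and uniqueness have just
  been shown.\<close>

definition minimizer :: "'b set \<Rightarrow> 'a" where "minimizer T = (THE u. approx_minimizer T u)"

lemma approx_minimizer_minimizer: "admissible T \<Longrightarrow> approx_minimizer T (minimizer T)"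
  unfolding minimizer_def using approx_minimizer_exists approx_minimizer_unique by (metis the_equality)

text \<open>A strict dominator of \<open>u\<close> with margin \<open>d\<close> would beat the
  infimum: approximate feasibility and semicontinuity cost \<open>d/4\<close> each, leaving a gain
  of \<open>d/2\<close>.\<close>

lemma approx_minimizer_in_W_p:
  assumes T: "admissible T" and u: "approx_minimizer T u"
  shows "u \<in> W_p C F K"
  unfolding W_p_iff
proof (intro conjI ballI notI)
  show uK: "u \<in> K" using u by (simp add: approx_minimizer_def)
  fix v assume v: "v \<in> K" "ll_p C (F v) (F u)"
  then obtain y d where y: "y \<in> F u" "d > 0" "\<And>a. a \<in> F v \<Longrightarrow> y - d *\<^sub>R e - a \<in> C"
    unfolding ll_p_iff by metis
  obtain r where r: "r > 0" "\<And>u'. dist u' u < r \<Longrightarrow> y - (d/4) *\<^sub>R e \<in> down (F u')"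
    using lsc_near[OF uK y(1), of "d/4"] y(2) by auto
  obtain u' where u': "dist u' u < min r (d/4)" "feasible T (target_value T + min r (d/4)) u'"
    using u r y(2) unfolding approx_minimizer_def by (metis min_less_iff_conj zero_less_divide_iff zero_less_numeral)
  then have "feasible T (target_value T + d/4) u'" by (auto elim: feasible_mono)
  then obtain b where b: "b \<in> T" "\<And>a. a \<in> F u' \<Longrightarrow> b + (target_value T + d/4) *\<^sub>R e - a \<in> C"
    unfolding feasible_def by blast
  obtain a' where a': "a' \<in> F u'" "a' - (y - (d/4) *\<^sub>R e) \<in> C"
    using r(2)[of u'] u' by (auto simp: down_def)
  have "b + (target_value T - d/2) *\<^sub>R e - a \<in> C" if "a \<in> F v" for a
  proof -
    have split: "b + (target_value T - d/2) *\<^sub>R e - a = (b + (target_value T + d/4) *\<^sub>R e - a')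
        + (a' - (y - (d/4) *\<^sub>R e)) + (y - d *\<^sub>R e - a)"
      by (simp add: algebra_simps flip: scaleR_add_left)
    show ?thesis unfolding split using a' b(2) y(3)[OF that] by (intro cone_add)
  qed
  then have "feasible T (target_value T - d/2) v" using b(1) unfolding feasible_def by blast
  from target_value_le[OF T v(1) this] y(2) show False by simp
qed

section \<open>The regularised targets\<close>

definition target :: "real \<Rightarrow> 'a \<Rightarrow> 'b set" where
  "target k x = {y. \<forall>u\<in>K. y - (k * dist x u) *\<^sub>R e \<in> down (F u)}"

lemma target_lower: "\<lbrakk>y \<in> target k x; y - y' \<in> C\<rbrakk> \<Longrightarrow> y' \<in> target k x"
  unfolding target_def by (auto intro: down_closed)

lemma target_convex: "convex (target k x)"
proof -
  have "target k x = (\<Inter>u\<in>K. (+) ((k * dist x u) *\<^sub>R e) ` down (F u))"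
    unfolding target_def
    by (auto simp: image_iff algebra_simps) (metis add_diff_cancel_left' add.commute diff_add_cancel)+
  then show ?thesis
    using down_values_convex by (simp add: convex_INT convex_translation)
qed

lemma target_nonempty:
  assumes "k \<ge> 0" shows "target k x \<noteq> {}"
proof -
  obtain R where R: "\<And>u. u \<in> K \<Longrightarrow> - (R *\<^sub>R e) \<in> down (F u)" using lower_bound by blast
  have "- (R *\<^sub>R e) - (k * dist x u) *\<^sub>R e \<in> down (F u)" if "u \<in> K" for u
    by (rule down_closed[OF R[OF that]]) (simp add: scale_e assms)
  then have "- (R *\<^sub>R e) \<in> target k x" by (simp add: target_def)
  then show ?thesis by blast
qed

lemma target_admissible:
  assumes "k \<ge> 0" and pos: "\<And>s u. \<lbrakk>u \<in> K; feasible (target k x) s u\<rbrakk> \<Longrightarrow> 0 \<le> s"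
  shows "admissible (target k x)"
  unfolding admissible_def
  using target_convex target_nonempty[OF assms(1)] target_lower pos by (intro conjI ballI allI impI)

text \<open>The penalty vanishes at \<open>u = x\<close>, so the target lies in
  \<open>down (F x)\<close>. A negative level would then be strict domination of \<open>F x\<close>
  with margin \<open>- s\<close>.\<close>

lemma target_admissible_W_p:
  assumes "k \<ge> 0" "x \<in> W_p C F K" shows "admissible (target k x)"
proof (rule target_admissible[OF assms(1)])
  fix s u assume u: "u \<in> K" "feasible (target k x) s u"
  have xK: "x \<in> K" using assms by (simp add: W_p_iff)
  obtain b where b: "b \<in> target k x" "\<And>a. a \<in> F u \<Longrightarrow> b + s *\<^sub>R e - a \<in> C"
    using u(2) unfolding feasible_def by blast
  have bx: "b \<in> down (F x)" using b(1) xK unfolding target_def by fastforce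
  show "0 \<le> s"
  proof (rule ccontr)
    assume "\<not> 0 \<le> s"
    then have "ll_p C (F u) (F x)" using b(2) by (intro ll_p_downI[OF bx, of "- s"]) auto
    with assms u show False by (simp add: W_p_iff)
  qed
qed

text \<open>Without a penalty the target lies below every value, including the one being tested, so
  no weakly minimal \<open>x\<close> has to be known. This is what yields
  \<open>W_p_nonempty\<close>.\<close>

lemma target_zero_admissible: "admissible (target 0 x)"
proof (rule target_admissible)
  fix s u assume u: "u \<in> K" "feasible (target 0 x) s u"
  obtain b where b: "b \<in> target 0 x" "\<And>a. a \<in> F u \<Longrightarrow> b + s *\<^sub>R e - a \<in> C"
    using u(2) unfolding feasible_def by blast
  obtain a where a: "a \<in> F u" "a - b \<in> C" using b(1) u(1) by (auto simp: target_def down_def)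
  have "s *\<^sub>R e \<in> C" by (rule cone_add_eq[OF b(2)[OF a(1)] a(2)]) simp
  then show "0 \<le> s" by (rule scale_e_nonneg)
qed simp

lemma W_p_nonempty: "W_p C F K \<noteq> {}"
  using approx_minimizer_in_W_p[OF target_zero_admissible approx_minimizer_minimizer[OF target_zero_admissible]] by blast

text \<open>A change of the penalty by at most \<open>r\<close> on \<open>K\<close> is compensated
  by moving the target point down by \<open>r *\<^sub>R e\<close>.\<close>

lemma feasible_target_shift:
  assumes "feasible (target k x) s u" and "\<And>w. w \<in> K \<Longrightarrow> k * dist x w \<le> k' * dist x' w + r"
  shows "feasible (target k' x') (s + r) u"
proof -
  obtain b where b: "b \<in> target k x" "\<And>a. a \<in> F u \<Longrightarrow> b + s *\<^sub>R e - a \<in> C"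
    using assms(1) unfolding feasible_def by blast
  have "b - r *\<^sub>R e \<in> target k' x'" unfolding target_def
  proof (intro CollectI ballI)
    fix w assume w: "w \<in> K"
    have b_down: "b - (k * dist x w) *\<^sub>R e \<in> down (F w)" using b(1) w by (simp add: target_def)
    have "(k' * dist x' w + r - k * dist x w) *\<^sub>R e \<in> C"
      using assms(2)[OF w] by (intro scale_e) simp
    then show "b - r *\<^sub>R e - (k' * dist x' w) *\<^sub>R e \<in> down (F w)"
      by (intro down_closed[OF b_down]) (simp add: algebra_simps)
  qed
  then show ?thesis unfolding feasible_def
    using b(2) by (intro bexI[of _ "b - r *\<^sub>R e"]) (auto simp: algebra_simps)
qed

section \<open>Stability of the minimisers under change of target\<close>

text \<open>Continuity in exclusion form: each wrong value \<open>w\<close> stays at a positive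
  distance from the minimisers for nearby penalties. This works because the gain in
  \<open>feasible_improve\<close> does not depend on the target.\<close>

lemma minimizer_separated:
  assumes k: "k \<ge> 0" and x: "x \<in> W_p C F K" and w: "w \<in> K" "w \<noteq> minimizer (target k x)"
  obtains r where "r > 0"
    "\<And>k' x'. \<lbrakk>k' \<ge> 0; x' \<in> W_p C F K;
        \<And>u. u \<in> K \<Longrightarrow> \<bar>k * dist x u - k' * dist x' u\<bar> \<le> r\<rbrakk>
       \<Longrightarrow> dist (minimizer (target k' x')) w \<ge> r"
proof -
  define T h where "T = target k x" and "h = minimizer T"
  have T: "admissible T" unfolding T_def by (rule target_admissible_W_p[OF k x])
  have h: "approx_minimizer T h" unfolding h_def by (rule approx_minimizer_minimizer[OF T])
  have "w \<noteq> h" using w by (simp add: h_def T_def)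
  then obtain v d where v: "v \<in> K" "d > 0" and imp:
    "\<And>u' w' T s s'. \<lbrakk>dist u' h < d; dist w' w < d; admissible T; feasible T s u'; feasible T s' w'\<rbrakk>
       \<Longrightarrow> feasible T ((s + s') / 2 - d) v"
    using feasible_improve[of h w] h w unfolding approx_minimizer_def by metis
  show thesis
  proof (rule that[of "d/4"])
    fix k' x' assume k': "k' \<ge> 0" "x' \<in> W_p C F K"
      and close: "\<And>u. u \<in> K \<Longrightarrow> \<bar>k * dist x u - k' * dist x' u\<bar> \<le> d/4"
    define T' where "T' = target k' x'"
    have T': "admissible T'" unfolding T'_def by (rule target_admissible_W_p[OF k'])
    have fwd: "feasible T' (s + d/4) u" if "feasible T s u" for s u
      unfolding T'_def
    proof (rule feasible_target_shift[OF that[unfolded T_def]])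
      fix w assume "w \<in> K"
      then show "k * dist x w \<le> k' * dist x' w + d/4" using close[of w] by linarith
    qed
    have bwd: "feasible T (s + d/4) u" if "feasible T' s u" for s u
      unfolding T_def
    proof (rule feasible_target_shift[OF that[unfolded T'_def]])
      fix w assume "w \<in> K"
      then show "k' * dist x' w \<le> k * dist x w + d/4" using close[of w] by linarith
    qed
    show "dist (minimizer (target k' x')) w \<ge> d/4"
    proof (rule ccontr)
      assume near: "\<not> ?thesis"
      obtain w' where w': "w' \<in> K" "dist w' (minimizer T') < d/4" "feasible T' (target_value T' + d/4) w'"
        using approx_minimizer_minimizer[OF T'] v(2) unfolding approx_minimizer_def by (metis zero_less_divide_iff zero_less_numeral)
      obtain h' where h': "h' \<in> K" "dist h' h < d/4" "feasible T (target_value T + d/4) h'"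
        using h v(2) unfolding approx_minimizer_def by (metis zero_less_divide_iff zero_less_numeral)
      have "dist w' w < d"
        using near w'(2) v(2) dist_triangle[of w' w "minimizer T'"] by (simp add: T'_def)
      have "target_value T \<le> target_value T' + d/4"
        using target_value_approx[OF T'] bwd target_value_le[OF T] by (smt (verit) field_le_epsilon)
      \<comment> \<open>The improvement is applied to the perturbed target. As the infimum for
        \<open>T\<close> is at most \<open>d/4\<close> above that for \<open>T'\<close>, the new
        level is at most \<open>target_value T' - d/2\<close>.\<close>
      have "feasible T' ((target_value T + d/4 + d/4 + (target_value T' + d/4)) / 2 - d) v"
        using h' v(2) \<open>dist w' w < d\<close> T' w'(3) fwd[OF h'(3)] by (intro imp) auto
      from target_value_le[OF T' v(1) this] \<open>target_value T \<le> _\<close> v(2) show False by (simp add: field_simps)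
    qed
  qed (use v in auto)
qed

text \<open>This gives continuity of the homotopy at \<open>t = 0\<close>.\<close>

lemma minimizer_separated_zero:
  assumes x: "x \<in> W_p C F K" and w: "w \<in> K" "w \<noteq> x"
  obtains r where "r > 0"
    "\<And>k x'. \<lbrakk>k \<ge> 1 / r; x' \<in> W_p C F K; dist x' x < r\<rbrakk> \<Longrightarrow> dist (minimizer (target k x')) w \<ge> r"
proof -
  have xK: "x \<in> K" using x by (simp add: W_p_iff)
  obtain v z d where v: "v \<in> K" "z \<in> F x" "d > 0" and imp:
    "\<And>u' T s s'. \<lbrakk>dist u' w < d; admissible T; feasible T s u'; z - (d + s') *\<^sub>R e \<in> T\<rbrakk>
       \<Longrightarrow> feasible T ((s + s') / 2 - d) v"
    using feasible_improve_target[OF w(1) xK w(2)] by metis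
  obtain m where m: "m > 0" "\<And>u. dist u x < m \<Longrightarrow> z - d *\<^sub>R e \<in> down (F u)"
    using lsc_near[OF xK v(2,3)] by auto
  obtain R where R: "R \<ge> 0" "\<And>u. u \<in> K \<Longrightarrow> - (R *\<^sub>R e) \<in> down (F u)" using lower_bound by blast
  obtain q where q: "q \<ge> 0" "q *\<^sub>R e + (- z) \<in> C" using absorb by blast
  \<comment> \<open>The bound \<open>m/2\<close> keeps points at distance at least \<open>m\<close>
    from \<open>x\<close> at distance at least \<open>m/2\<close> from \<open>x'\<close>; the second
    bound makes \<open>k * (m/2)\<close> exceed \<open>R + q\<close>; the third leaves room in the
    final contradiction.\<close>
  define r where "r = min (m/2) (min (m / (2 * (R + q + 1))) (d/2))"
  have "r > 0" using m(1) v(3) R(1) q(1) by (simp add: r_def add_nonneg_pos)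
  moreover have "r \<le> m/2" "r \<le> m / (2 * (R + q + 1))" "r \<le> d/2"
    unfolding r_def by (meson min.cobounded1 min.cobounded2 order_trans)+
  ultimately have r: "r > 0" "r \<le> m/2" "r \<le> m / (2 * (R + q + 1))" "r \<le> d/2" .
  show thesis
  proof (rule that[OF r(1)])
    fix k x' assume k: "k \<ge> 1 / r" and x': "x' \<in> W_p C F K" "dist x' x < r"
    have k0: "k \<ge> 0" using k r(1) by (meson divide_nonneg_pos order_trans zero_le_one)
    define T where "T = target k x'"
    have T: "admissible T" unfolding T_def by (rule target_admissible_W_p[OF k0 x'(1)])
    \<comment> \<open>For \<open>u\<close> near \<open>x\<close> this is semicontinuity; for
      \<open>u\<close> far away the large penalty pushes the point below the uniform lower bound. It
      replaces a second feasible point, at level 0.\<close>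
    have "z - d *\<^sub>R e \<in> T"
      unfolding T_def target_def
    proof (intro CollectI ballI)
      fix u assume u: "u \<in> K"
      show "z - d *\<^sub>R e - (k * dist x' u) *\<^sub>R e \<in> down (F u)"
      proof (cases "dist u x < m")
        case True
        show ?thesis by (rule down_closed[OF m(2)[OF True]]) (simp add: scale_e k0)
      next
        case False
        have "m \<le> dist x' u + dist x' x"
          using False dist_triangle[of u x x'] by (simp add: dist_commute)
        then have far: "m / 2 \<le> dist x' u" using x'(2) r(2) by simp
        have "R + q \<le> 1 / r * (m / 2)"
          using r(1,3) R(1) q(1) m(1) by (simp add: field_simps)
        also have "\<dots> \<le> k * dist x' u"
          using k k0 far m(1) by (intro mult_mono) auto
        finally have "(k * dist x' u - R - q + d) *\<^sub>R e \<in> C" using v(3) by (intro scale_e) simp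
        from cone_add[OF this q(2)]
        have "- (R *\<^sub>R e) - (z - d *\<^sub>R e - (k * dist x' u) *\<^sub>R e) \<in> C"
          by (simp add: algebra_simps)
        with R(2)[OF u] show ?thesis by (rule down_closed)
      qed
    qed
    then have zT: "z - (d + 0) *\<^sub>R e \<in> T" by simp
    show "dist (minimizer (target k x')) w \<ge> r"
    proof (rule ccontr)
      assume near: "\<not> ?thesis"
      obtain w' where w': "w' \<in> K" "dist w' (minimizer T) < r" "feasible T (target_value T + r) w'"
        using approx_minimizer_minimizer[OF T] r(1) unfolding approx_minimizer_def by metis
      have "dist w' w < d"
        using near w'(2) r dist_triangle[of w' w "minimizer T"] by (simp add: T_def)
      \<comment> \<open>This level is smaller than the infimum because \<open>target_value T\<close>
        is nonnegative and \<open>r \<le> d/2\<close>.\<close>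
      have "feasible T ((target_value T + r + 0) / 2 - d) v"
        using \<open>dist w' w < d\<close> T w'(3) zT by (rule imp)
      from target_value_le[OF T v(1) this] target_value_nonneg[OF T] r v(3) show False by (simp add: field_simps)
    qed
  qed
qed

section \<open>Continuity and the contracting homotopy\<close>

text \<open>Outside a neighbourhood \<open>U\<close> of \<open>f p\<close>, the compact set
  \<open>K - U\<close> is covered by finitely many of the locally excluded balls, so nearby values
  of \<open>f\<close> must lie in \<open>U\<close>.\<close>

lemma continuous_on_separated:
  fixes f :: "'c::topological_space \<Rightarrow> 'a"
  assumes im: "\<And>p. p \<in> S \<Longrightarrow> f p \<in> K"
    and sep: "\<And>p w. \<lbrakk>p \<in> S; w \<in> K; w \<noteq> f p\<rbrakk>
       \<Longrightarrow> \<exists>r>0. \<forall>\<^sub>F q in at p within S. dist (f q) w \<ge> r"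
  shows "continuous_on S f"
  unfolding continuous_on_def
proof (intro ballI topological_tendstoI)
  fix p U assume p: "p \<in> S" and U: "open U" "f p \<in> U"
  have "\<forall>w\<in>K - U. \<exists>r>0. \<forall>\<^sub>F q in at p within S. dist (f q) w \<ge> r"
    using sep[OF p] U by blast
  then obtain r where r: "\<And>w. w \<in> K - U \<Longrightarrow> r w > 0"
    "\<And>w. w \<in> K - U \<Longrightarrow> \<forall>\<^sub>F q in at p within S. dist (f q) w \<ge> r w"
    by metis
  have "compact (K - U)" using K_compact U(1) by (rule compact_diff)
  then obtain D where D: "D \<subseteq> K - U" "finite D" "K - U \<subseteq> (\<Union>w\<in>D. ball w (r w))"
    by (rule compactE_image[of _ "K - U" "\<lambda>w. ball w (r w)"]) (use r in auto)
  have "\<forall>\<^sub>F q in at p within S. \<forall>w\<in>D. dist (f q) w \<ge> r w"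
    using D r by (intro eventually_ball_finite) auto
  moreover have "\<forall>\<^sub>F q in at p within S. q \<in> S"
    unfolding eventually_at_topological by (rule exI[of _ UNIV]) simp
  ultimately show "\<forall>\<^sub>F q in at p within S. f q \<in> U"
  proof eventually_elim
    case (elim q)
    then show ?case using im[of q] D(3) by (force simp: dist_commute)
  qed
qed

lemma W_p_contractible: "contractible (W_p C F K)"
proof -
  let ?W = "W_p C F K"
  \<comment> \<open>The penalty factor decreases from infinity to 0 as \<open>t\<close> runs from 0
    to 1. Time runs opposite to the informal definition of contractibility: the identity sits at
    \<open>t = 0\<close>.\<close>
  define H where "H = (\<lambda>(t::real, x). if t = 0 then x else minimizer (target (1 / t - 1) x))"
  have tk: "1 / t - 1 \<ge> 0" if "t \<in> {0..1}" "t \<noteq> 0" for t :: real using that by (simp add: field_simps)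
  have HW: "H p \<in> ?W" if p: "p \<in> {0..1} \<times> ?W" for p
  proof -
    obtain t x where tx: "p = (t, x)" "t \<in> {0..1}" "x \<in> ?W" using p by (cases p) auto
    show ?thesis
    proof (cases "t = 0")
      case False
      have "admissible (target (1 / t - 1) x)"
        using tk[OF tx(2) False] tx(3) by (rule target_admissible_W_p)
      then have "minimizer (target (1 / t - 1) x) \<in> ?W" using approx_minimizer_in_W_p approx_minimizer_minimizer by blast
      with False tx(1) show ?thesis by (simp add: H_def)
    qed (use tx in \<open>simp add: H_def\<close>)
  qed
  have WK: "?W \<subseteq> K" by (auto simp: W_p_iff)
  obtain B where B: "\<And>u v. \<lbrakk>u \<in> K; v \<in> K\<rbrakk> \<Longrightarrow> dist u v \<le> B"
    using compact_imp_bounded[OF K_compact] by (metis bounded_two_points)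
  have "continuous_on ({0..1} \<times> ?W) H"
  proof (rule continuous_on_separated)
    fix p :: "real \<times> 'a" assume "p \<in> {0..1} \<times> ?W"
    then show "H p \<in> K" using HW WK by blast
  next
    fix p :: "real \<times> 'a" and w assume p: "p \<in> {0..1} \<times> ?W" and w: "w \<in> K" "w \<noteq> H p"
    obtain t x where tx: "p = (t, x)" "t \<in> {0..1}" "x \<in> ?W" using p by (cases p) auto
    let ?N = "at p within {0..1} \<times> ?W"
    have dom: "\<forall>\<^sub>F q in ?N. q \<in> {0..1} \<times> ?W"
      unfolding eventually_at_topological by (rule exI[of _ UNIV]) simp
    have lims: "(fst \<longlongrightarrow> t) ?N" "(snd \<longlongrightarrow> x) ?N"
      using tx by (auto intro!: tendsto_eq_intros)
    show "\<exists>r>0. \<forall>\<^sub>F q in ?N. dist (H q) w \<ge> r"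
    proof (cases "t = 0")
      case True
      then have "w \<noteq> x" using w tx by (simp add: H_def)
      then obtain r where r: "r > 0"
        "\<And>k x'. \<lbrakk>k \<ge> 1 / r; x' \<in> ?W; dist x' x < r\<rbrakk> \<Longrightarrow> dist (minimizer (target k x')) w \<ge> r"
        using minimizer_separated_zero[OF tx(3) w(1)] by metis
      \<comment> \<open>Chosen so that \<open>t' < c\<close> forces
        \<open>1 / t' - 1 \<ge> 1 / r\<close>.\<close>
      define c where "c = 1 / (1 / r + 1)"
      have c: "c > 0" using r by (simp add: c_def add_pos_pos)
      \<comment> \<open>The second bound serves the points with \<open>t' = 0\<close>, where
        \<open>H\<close> is the identity in \<open>x'\<close>.\<close>
      define r' where "r' = min r (dist x w / 2)"
      have r': "r' > 0" "r' \<le> r" "r' \<le> dist x w / 2" using r \<open>w \<noteq> x\<close> by (auto simp: r'_def)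
      have "\<forall>\<^sub>F q in ?N. fst q < c" using lims(1) c True by (auto intro: order_tendstoD)
      moreover have "\<forall>\<^sub>F q in ?N. dist (snd q) x < r'" using lims(2) r'(1) by (rule tendstoD)
      ultimately have "\<forall>\<^sub>F q in ?N. dist (H q) w \<ge> r'"
        using dom
      proof eventually_elim
        case (elim q)
        obtain t' x' where q: "q = (t', x')" by force
        show ?case
        proof (cases "t' = 0")
          case True
          then show ?thesis
            using elim q r'(3) dist_triangle2[of x w x'] dist_triangle[of x w x'] by (simp add: H_def dist_commute)
        next
          case False
          then have "t' > 0" using elim q by auto
          have "1 / t' \<ge> 1 / c" using elim q \<open>t' > 0\<close> by (intro divide_left_mono) auto
          then have "1 / t' - 1 \<ge> 1 / r" by (simp add: c_def)
          then have "dist (minimizer (target (1 / t' - 1) x')) w \<ge> r"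
            using elim q r'(2) by (intro r(2)) auto
          with False q r'(2) show ?thesis by (simp add: H_def)
        qed
      qed
      with r' show ?thesis by blast
    next
      case False
      define k where "k = 1 / t - 1"
      have k: "k \<ge> 0" unfolding k_def using tk tx False by blast
      have "w \<noteq> minimizer (target k x)" using w tx False by (simp add: H_def k_def)
      then obtain r where r: "r > 0"
        "\<And>k' x'. \<lbrakk>k' \<ge> 0; x' \<in> ?W; \<And>u. u \<in> K \<Longrightarrow> \<bar>k * dist x u - k' * dist x' u\<bar> \<le> r\<rbrakk>
          \<Longrightarrow> dist (minimizer (target k' x')) w \<ge> r"
        using minimizer_separated[OF k tx(3) w(1)] by metis
      \<comment> \<open>This expression dominates the change of the penalty uniformly in
        \<open>u\<close>: the first term accounts for moving \<open>x\<close>, the second for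
        changing \<open>k\<close>. Its limit is 0.\<close>
      have "((\<lambda>q. k * dist x (snd q) + \<bar>k - (1 / fst q - 1)\<bar> * B) \<longlongrightarrow>
          k * dist x x + \<bar>k - (1 / t - 1)\<bar> * B) ?N"
        using False by (intro tendsto_intros lims)
      then have "\<forall>\<^sub>F q in ?N. k * dist x (snd q) + \<bar>k - (1 / fst q - 1)\<bar> * B < r"
        using r(1) by (intro order_tendstoD) (auto simp: k_def)
      moreover have "\<forall>\<^sub>F q in ?N. fst q > 0"
        using lims(1) tx False by (intro order_tendstoD) auto
      ultimately have "\<forall>\<^sub>F q in ?N. dist (H q) w \<ge> r"
        using dom
      proof eventually_elim
        case (elim q)
        obtain t' x' where q: "q = (t', x')" by force
        define k' where "k' = 1 / t' - 1"
        have "\<bar>k * dist x u - k' * dist x' u\<bar> \<le> r" if u: "u \<in> K" for u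
        proof -
          have "\<bar>k * dist x u - k' * dist x' u\<bar>
              = \<bar>k * (dist x u - dist x' u) + (k - k') * dist x' u\<bar>"
            by (simp add: algebra_simps)
          also have "\<dots> \<le> k * \<bar>dist x u - dist x' u\<bar> + \<bar>k - k'\<bar> * dist x' u"
            using k by (intro order_trans[OF abs_triangle_ineq]) (simp add: abs_mult)
          also have "\<dots> \<le> k * dist x x' + \<bar>k - k'\<bar> * B"
            using k B[of x' u] elim q WK u abs_dist_diff_le[of x u x']
            by (intro add_mono mult_left_mono) (auto simp: dist_commute)
          finally show ?thesis using elim q by (simp add: k'_def)
        qed
        then have "dist (minimizer (target k' x')) w \<ge> r"
          using elim q tk[of t'] by (intro r(2)) (auto simp: k'_def)
        then show ?case using elim q by (simp add: H_def k'_def)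
      qed
      with r show ?thesis by blast
    qed
  qed
  then have "continuous_map (prod_topology (top_of_set {0..1}) (top_of_set ?W)) (top_of_set ?W) H"
    using HW by (auto simp: prod_topology_subtopology_eu continuous_map_subtopology_eu)
  \<comment> \<open>At \<open>t = 1\<close> the penalty vanishes and the target no longer depends on
    the base point, so \<open>undefined\<close> is a harmless placeholder.\<close>
  moreover have "H (0, x) = x" "H (1, x) = minimizer (target 0 undefined)" for x
    by (auto simp: H_def target_def)
  ultimately have "homotopic_with_canon (\<lambda>_. True) ?W ?W id (\<lambda>_. minimizer (target 0 undefined))"
    unfolding homotopic_with_def by (intro exI[of _ H]) simp
  then show ?thesis unfolding contractible_def by blast
qed

end

section \<open>Transfer from the locale to the theorem\<close>

text \<open>The zero target space is excluded because there all points of \<open>K\<close> would be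
  weakly minimal, whatever the shape of \<open>K\<close>. Nonemptiness is stated separately since
  the library's \<open>contractible\<close> also holds for the empty set.\<close>

theorem theorem5p2:
  fixes K :: "'a::real_normed_vector set"
    and C :: "'b::banach set"
    and F :: "'a \<Rightarrow> 'b set"
  assumes "(UNIV :: 'b set) \<noteq> {0}"
    and "convex C" and "closed C" and "pointed_cone C" and "interior C \<noteq> {}"
    and "K \<noteq> {}" and "compact K"
    and "neg_cone_lsc_on C F K"
    and "strictly_p_convexlike_on C F K"
    and "\<And>x. x \<in> K \<Longrightarrow> F x \<noteq> {}"
    and "\<And>x. x \<in> K \<Longrightarrow> neg_cone_convex C (F x)"
    and "\<And>x. x \<in> K \<Longrightarrow> neg_cone_compact C (F x)"
  shows "(W_p C F K \<noteq> {} \<and> contractible (W_p C F K)) \<and>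
         (E_p C F K \<noteq> {} \<and> contractible (E_p C F K))"
proof -
  obtain e where e: "e \<in> interior C" using assms(5) by blast
  have scale: "r *\<^sub>R x \<in> C" if "x \<in> C" "0 \<le> r" for x and r :: real
    using assms(4) that by (auto simp: pointed_cone_def cone_def)
  have add: "x + y \<in> C" if "x \<in> C" "y \<in> C" for x y
  proof -
    have "(1/2) *\<^sub>R x + (1/2) *\<^sub>R y \<in> C" using assms(2) that by (intro convexD) auto
    from scale[OF this, of 2] show ?thesis by (simp add: scaleR_add_right)
  qed
  \<comment> \<open>Otherwise pointedness gives \<open>e = 0\<close>, so \<open>C\<close> contains a
    ball around 0 and is the whole space; pointedness then leaves only the zero space.\<close>
  have "- e \<notin> C"
  proof
    assume "- e \<in> C"
    moreover have "e \<in> C" using e interior_subset by blast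
    ultimately have "e = 0"
      using assms(4) unfolding pointed_cone_def by (metis IntI add.inverse_inverse image_eqI singletonD)
    then obtain d where d: "d > 0" "ball 0 d \<subseteq> C" using e mem_interior by metis
    have all: "y \<in> C" for y
    proof -
      define N where "N = norm y + 1"
      have N: "N > 0" "norm y < N" by (auto simp: N_def add_nonneg_pos)
      then have "(d / N) *\<^sub>R y \<in> ball 0 d" using d(1) by (simp add: pos_divide_less_eq)
      then have "(d / N) *\<^sub>R y \<in> C" using d(2) by blast
      from scale[OF this, of "N / d"] show ?thesis using d(1) N(1) by simp
    qed
    then have "(UNIV :: 'b set) = {0}"
      using assms(4) unfolding pointed_cone_def by (metis UNIV_I UNIV_eq_I Int_UNIV_left surj_uminus)
    with assms(1) show False by blast
  qed
  then interpret strict_cone_problem C e F K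
    using add scale e assms by unfold_locales auto
  show ?thesis using W_p_nonempty W_p_contractible by (simp add: E_p_eq_W_p)
qed

end
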